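(* Let $\mu>0$ and let $\boldsymbol p=(p_1,\dots,p_m)$ be a vector of prior bounds $p_j\in(0,1)$. Any $\mu$-GDP mechanism $\mathcal A$ provides $(\boldsymbol p,\boldsymbol r)$-secret protection, where for every $j$ $$r_j=1-\Phi\big(\Phi^{-1}(1-p_j)-\mu\big).$$
   Context: $\Phi$ is the standard normal CDF. **Trade-off function.** For distributions $P,Q$ on the same space, $T_{(P,Q)}(\alpha)=\inf\{\beta_\phi:\alpha_\phi\le\alpha\}$ for $\alpha\in[0,1]$. The infimum is over (randomized) rejection rules $\phi$ with values in $[0,1]$ for testing $H_0:P$ against $H_1:Q$, with type I error $\alpha_\phi=\mathbb E_P[\phi]$ and type II error $\beta_\phi=1-\mathbb E_Q[\phi]$. **$\mu$-GDP.** A randomized mechanism $\mathcal A$ is $\mu$-GDP (Gaussian differentially private) if for every pair of neighboring datasets (datasets that differ in exactly one record), with output distributions $P,Q$, one has $T_{(P,Q)}(\alpha)\ge G_\mu(\alpha):=\Phi(\Phi^{-1}(1-\alpha)-\mu)$ for all $\alpha\in[0,1]$. **Secret protection.** Let $D=\{x_1,\dots,x_n\}$ be a dataset whose records may contain secrets from $S=\{s_1,\dots,s_m\}$. For a secret $s_j$, let $\{D_j^1,\dots,D_j^K\}$ be candidate datasets such that $D$ and each $D_j^k$ differ exclusively in the presence of $s_j$, and let $\pi_j$ be a prior on these candidates with $\Pr_{\pi_j}(D_j^k)\le p_j$ for all $k$. A randomized mechanism $\mathcal A$ satisfies $(\boldsymbol p,\boldsymbol r)$-secret protection if for every $j$,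 every such candidate family and prior $\pi_j$, and every reconstruction attack $B$ (a map from outputs of $\mathcal A$ to $\{1,\dots,K\}$), $\Pr_{k\sim\pi_j,\ \mathcal A}[B(\mathcal A(D_j^k))=k]\le r_j$. **Standing convention on neighbors.** The neighboring relation is aligned with the secrets: $D$ and each candidate $D_j^k$ differ only by a single element, namely one record $x\in D$ with $s_j\in x$ is replaced by a record $x'\in D_j^k$ with $s_j\notin x'$. *)

theory Defs
  imports "HOL-Probability.Probability"
begin

text \<open>
  The normal CDF is taken on the extended reals, so that it is a bijection onto \<open>[0,1]\<close> and its
  inverse makes sense at the endpoints: \<open>\<Phi>\<inverse>(0) = -\<infinity>\<close>, \<open>\<Phi>\<inverse>(1) = \<infinity>\<close>. These values
  occur in the Gaussian trade-off function at \<open>\<alpha> = 1\<close> and \<open>\<alpha> = 0\<close>. On reals,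
  \<open>std_normal_cdf (ereal x) = cdf std_normal_distribution x\<close>.
\<close>

definition std_normal_cdf :: "ereal \<Rightarrow> real" where
  "std_normal_cdf x = measure std_normal_distribution {y. ereal y \<le> x}"

text \<open>Only meaningful for arguments in \<open>[0,1]\<close>.\<close>

definition std_normal_quantile :: "real \<Rightarrow> ereal" where
  "std_normal_quantile = inv std_normal_cdf"

definition rejection_rule :: "'o measure \<Rightarrow> ('o \<Rightarrow> real) \<Rightarrow> bool" where
  "rejection_rule N \<phi> \<longleftrightarrow> \<phi> \<in> borel_measurable N \<and> (\<forall>y\<in>space N. 0 \<le> \<phi> y \<and> \<phi> y \<le> 1)"

definition type_I_error :: "'o measure \<Rightarrow> ('o \<Rightarrow> real) \<Rightarrow> real" where
  "type_I_error P \<phi> = (\<integral>y. \<phi> y \<partial>P)"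

definition type_II_error :: "'o measure \<Rightarrow> ('o \<Rightarrow> real) \<Rightarrow> real" where
  "type_II_error Q \<phi> = 1 - (\<integral>y. \<phi> y \<partial>Q)"

text \<open>
  \<open>P\<close> and \<open>Q\<close> are meant to be probability measures on the same measurable space. For
  \<open>\<alpha> \<ge> 0\<close> the infimum is over a nonempty set of reals bounded below by \<open>0\<close>.
\<close>

definition tradeoff :: "'o measure \<Rightarrow> 'o measure \<Rightarrow> real \<Rightarrow> real" where
  "tradeoff P Q \<alpha> = Inf {type_II_error Q \<phi> |\<phi>. rejection_rule P \<phi> \<and> type_I_error P \<phi> \<le> \<alpha>}"

definition gaussian_tradeoff :: "real \<Rightarrow> real \<Rightarrow> real" where
  "gaussian_tradeoff \<mu> \<alpha> = std_normal_cdf (std_normal_quantile (1 - \<alpha>) - ereal \<mu>)"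

text \<open>
  A dataset is a finite multiset of records of type \<open>'x\<close>. Two datasets are neighboring if one
  arises from the other by replacing a single record.
\<close>

definition neighboring :: "'x multiset \<Rightarrow> 'x multiset \<Rightarrow> bool" where
  "neighboring D D' \<longleftrightarrow>
     (\<exists>R x x'. x \<noteq> x' \<and> D = add_mset x R \<and> D' = add_mset x' R)"

text \<open>
  A randomized mechanism with outputs in the measurable space \<open>N\<close> is given by its output
  distributions.
\<close>

definition mechanism :: "'o measure \<Rightarrow> ('x multiset \<Rightarrow> 'o measure) \<Rightarrow> bool" where
  "mechanism N A \<longleftrightarrow> (\<forall>D. A D \<in> space (prob_algebra N))"

definition gdp :: "real \<Rightarrow> ('x multiset \<Rightarrow> 'o measure) \<Rightarrow> bool" where
  "gdp \<mu> A \<longleftrightarrow>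
     (\<forall>D D'. neighboring D D' \<longrightarrow>
        (\<forall>\<alpha>\<in>{0..1}. tradeoff (A D) (A D') \<alpha> \<ge> gaussian_tradeoff \<mu> \<alpha>))"

text \<open>
  \<open>has t x\<close> expresses that the record \<open>x\<close> contains the secret \<open>t\<close>.
\<close>

definition candidate :: "('s \<Rightarrow> 'x \<Rightarrow> bool) \<Rightarrow> 's \<Rightarrow> 'x multiset \<Rightarrow> 'x multiset \<Rightarrow> bool" where
  "candidate has t D D' \<longleftrightarrow>
     (\<exists>R x x'. has t x \<and> \<not> has t x' \<and> D = add_mset x R \<and> D' = add_mset x' R)"

text \<open>
  Joint law of \<open>(k, y)\<close>, where the index \<open>k\<close> is drawn from the prior \<open>\<pi>\<close> and then the output
  \<open>y\<close> is drawn from the mechanism run on the candidate \<open>C k\<close>.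
\<close>

definition attack_experiment ::
  "'o measure \<Rightarrow> ('x multiset \<Rightarrow> 'o measure) \<Rightarrow> (nat \<Rightarrow> 'x multiset) \<Rightarrow> nat pmf \<Rightarrow> (nat \<times> 'o) measure"
where
  "attack_experiment N A C \<pi> =
     measure_pmf \<pi> \<bind> (\<lambda>k. distr (A (C k)) (count_space UNIV \<Otimes>\<^sub>M N) (\<lambda>y. (k, y)))"

definition attack_success ::
  "'o measure \<Rightarrow> ('x multiset \<Rightarrow> 'o measure) \<Rightarrow> (nat \<Rightarrow> 'x multiset) \<Rightarrow> nat pmf \<Rightarrow> ('o \<Rightarrow> nat) \<Rightarrow> real"
where
  "attack_success N A C \<pi> B =
     \<P>((k, y) in attack_experiment N A C \<pi>. B y = k)"

text \<open>
  The secrets are \<open>s 1, \<dots>, s m\<close>; only the values \<open>p j\<close>, \<open>r j\<close> for \<open>1 \<le> j \<le> m\<close> matter.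
  The candidates \<open>C 1, \<dots>, C K\<close> form an indexed family with the prior on the indices. They need
  not be distinct; for distinct candidates this is the same as a prior on the datasets.
\<close>

definition secret_protection ::
  "'o measure \<Rightarrow> ('s \<Rightarrow> 'x \<Rightarrow> bool) \<Rightarrow> nat \<Rightarrow> (nat \<Rightarrow> 's) \<Rightarrow> (nat \<Rightarrow> real) \<Rightarrow> (nat \<Rightarrow> real)
     \<Rightarrow> ('x multiset \<Rightarrow> 'o measure) \<Rightarrow> bool"
where
  "secret_protection N has m s p r A \<longleftrightarrow>
     (\<forall>j\<in>{1..m}. \<forall>D K C \<pi> B.
        (\<forall>k\<in>{1..K}. candidate has (s j) D (C k)) \<longrightarrow>
        set_pmf \<pi> \<subseteq> {1..K} \<longrightarrow>
        (\<forall>k\<in>{1..K}. pmf \<pi> k \<le> p j) \<longrightarrow>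
        B \<in> N \<rightarrow>\<^sub>M count_space {1..K} \<longrightarrow>
        attack_success N A C \<pi> B \<le> r j)"

end

theory Submission
  imports Defs
begin

text \<open>
  Let \<open>P\<close> be the output law on \<open>D\<close>, \<open>P\<^sub>k\<close> the one on the \<open>k\<close>-th candidate, and
  \<open>E\<^sub>k = {B = k}\<close>. With \<open>F = 1 - G\<^sub>\<mu>\<close>, testing \<open>P\<close> against \<open>P\<^sub>k\<close> by the indicator of \<open>E\<^sub>k\<close>
  gives \<open>P\<^sub>k(E\<^sub>k) \<le> F(P(E\<^sub>k))\<close>. The function \<open>F\<close> lies below a line of nonnegative slope that touches
  it at \<open>p\<close>, and \<open>\<Sum>\<^sub>k \<pi>\<^sub>k P(E\<^sub>k) \<le> p \<Sum>\<^sub>k P(E\<^sub>k) = p\<close> since the \<open>E\<^sub>k\<close> partition the output space;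
  averaging over \<open>\<pi>\<close> gives the bound \<open>F(p)\<close>.
\<close>

section \<open>The Gaussian trade-off function\<close>

lemma std_normal_cdf_eq_cdf: "std_normal_cdf (ereal x) = cdf std_normal_distribution x"
  by (simp add: std_normal_cdf_def cdf_def atMost_def)

lemma isCont_std_normal_cdf: "isCont (cdf std_normal_distribution) x"
proof -
  interpret real_distribution std_normal_distribution
    by (rule real_dist_normal_dist)
  have "emeasure std_normal_distribution {x} = 0"
    by (subst emeasure_density) (auto simp: nn_integral_indicator_singleton)
  then show ?thesis
    by (simp add: isCont_cdf measure_def)
qed

text \<open>The endpoints are attained at \<open>-\<infinity>\<close> and
  \<open>\<infinity>\<close>, interior values by continuity. This makes \<open>inv\<close> a genuine
  right inverse on the closed unit interval.\<close>

lemma std_normal_cdf_surj: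
  assumes "a \<in> {0..1}"
  shows "\<exists>u. std_normal_cdf u = a"
proof -
  interpret real_distribution std_normal_distribution
    by (rule real_dist_normal_dist)
  consider "a = 0" | "a = 1" | "0 < a" "a < 1"
    using assms by fastforce
  then show ?thesis
  proof cases
    case 1
    then have "std_normal_cdf (-\<infinity>) = a"
      by (simp add: std_normal_cdf_def)
    then show ?thesis ..
  next
    case 2
    then have "std_normal_cdf \<infinity> = a"
      using prob_space by (simp add: std_normal_cdf_def)
    then show ?thesis ..
  next
    case 3
    obtain b where b: "cdf std_normal_distribution b < a"
      using order_tendstoD(2)[OF cdf_lim_at_bot 3(1)] by (auto simp: eventually_at_bot_linorder)
    obtain c where c: "a < cdf std_normal_distribution c"
      using order_tendstoD(1)[OF cdf_lim_at_top_prob 3(2)] by (auto simp: eventually_at_top_linorder)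
    have "b \<le> c"
      using b c cdf_nondecreasing[of c b] by (cases "b \<le> c") auto
    then obtain x where "cdf std_normal_distribution x = a"
      using IVT[of "cdf std_normal_distribution" b a c] b c isCont_std_normal_cdf by fastforce
    then show ?thesis
      by (metis std_normal_cdf_eq_cdf)
  qed
qed

lemma std_normal_cdf_quantile:
  assumes "a \<in> {0..1}"
  shows "std_normal_cdf (std_normal_quantile a) = a"
  unfolding std_normal_quantile_def using std_normal_cdf_surj[OF assms]
  by (auto intro: f_inv_into_f)

text \<open>Infinite arguments give only the values 0 and 1. A real threshold is what allows a
  likelihood ratio to be evaluated there.\<close>

lemma std_normal_quantile_real:
  assumes "a \<in> {0<..<1}"
  obtains t where "std_normal_quantile a = ereal t"
proof -
  interpret real_distribution std_normal_distribution
    by (rule real_dist_normal_dist)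
  have "std_normal_cdf (-\<infinity>) = 0" "std_normal_cdf \<infinity> = 1"
    using prob_space by (simp_all add: std_normal_cdf_def)
  then show ?thesis
    using std_normal_cdf_quantile[of a] assms that
    by (cases "std_normal_quantile a") auto
qed

text \<open>Power of the test that rejects above \<open>u\<close> against the normal law with mean
  \<open>\<mu>\<close>, obtained by translation. The case of mean 0 gives its level.\<close>

lemma normal_upper_tail:
  "1 - std_normal_cdf (u - ereal \<mu>) =
     (\<integral>x. indicator {x. u < ereal x} x * normal_density \<mu> 1 x \<partial>lborel)"
proof -
  interpret real_distribution std_normal_distribution
    by (rule real_dist_normal_dist)
  let ?S = "{y. u - ereal \<mu> < ereal y}"
  have shift: "u < ereal (\<mu> + y) \<longleftrightarrow> u - ereal \<mu> < ereal y" for y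
    by (cases u) auto
  have meas: "{y. ereal y \<le> u - ereal \<mu>} \<in> sets borel"
    by measurable
  have "1 - std_normal_cdf (u - ereal \<mu>) = prob (space std_normal_distribution - {y. ereal y \<le> u - ereal \<mu>})"
    using meas by (subst prob_compl) (auto simp: std_normal_cdf_def)
  also have "space std_normal_distribution - {y. ereal y \<le> u - ereal \<mu>} = ?S"
    by auto
  also have "prob ?S = (\<integral>x. indicator ?S x \<partial>std_normal_distribution)"
    by simp
  also have "\<dots> = (\<integral>x. indicator ?S x * normal_density 0 1 x \<partial>lborel)"
    by (subst integral_density) (auto simp: mult.commute)
  \<comment> \<open>Substitute \<open>x = \<mu> + y\<close> in the right-hand integral.\<close>
  also have "\<dots> = (\<integral>x. indicator {x. u < ereal x} x * normal_density \<mu> 1 x \<partial>lborel)"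
    by (subst (2) lborel_integral_real_affine[where c=1 and t=\<mu>])
       (auto simp: shift normal_density_def indicator_def intro!: Bochner_Integration.integral_cong)
  finally show ?thesis .
qed

lemma integrable_upper_tail:
  "integrable lborel (\<lambda>x. indicator {x. u < ereal x} x * normal_density \<mu> 1 x)"
proof -
  have "{x. u < ereal x} \<in> sets borel"
    by measurable
  then show ?thesis
    using integrable_mult_indicator[of "{x. u < ereal x}" lborel "normal_density \<mu> 1"]
    by (simp add: integrable_normal_density)
qed

lemma normal_density_ratio:
  "normal_density \<mu> 1 x = exp (\<mu> * x - \<mu>\<^sup>2 / 2) * normal_density 0 1 x"
  by (simp add: normal_density_def exp_add[symmetric] power2_eq_square field_simps)

text \<open>
  The Neyman-Pearson argument: the slope \<open>c\<close> is the likelihood ratio at the threshold of the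
  optimal test of level \<open>p\<close>, which therefore maximises power minus \<open>c\<close> times level.
\<close>

lemma gaussian_tradeoff_supporting_line:
  assumes "\<mu> > 0" "p \<in> {0<..<1}"
  obtains c where "c \<ge> 0"
    "\<And>q. q \<in> {0..1} \<Longrightarrow> 1 - gaussian_tradeoff \<mu> q \<le> 1 - gaussian_tradeoff \<mu> p + c * (q - p)"
proof -
  obtain t where t: "std_normal_quantile (1 - p) = ereal t"
    using std_normal_quantile_real[of "1 - p"] assms by auto
  define c where "c = exp (\<mu> * t - \<mu>\<^sup>2 / 2)"
  define h where "h x = normal_density \<mu> 1 x - c * normal_density 0 1 x" for x
  \<comment> \<open>Power minus \<open>c\<close> times level, for the threshold test of level
    \<open>q\<close>, written as one integral of \<open>h\<close> over the rejection region.\<close>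
  have lagrangian: "1 - gaussian_tradeoff \<mu> q - c * q =
       (\<integral>x. indicator {x. std_normal_quantile (1 - q) < ereal x} x * h x \<partial>lborel)"
    and int: "integrable lborel (\<lambda>x. indicator {x. std_normal_quantile (1 - q) < ereal x} x * h x)"
    if q: "q \<in> {0..1}" for q
  proof -
    let ?u = "std_normal_quantile (1 - q)"
    let ?g = "\<lambda>\<nu> x. indicator {x. ?u < ereal x} x * normal_density \<nu> 1 x"
    have h: "indicator {x. ?u < ereal x} x * h x = ?g \<mu> x - c * ?g 0 x" for x
      by (simp add: h_def algebra_simps)
    have "(\<integral>x. ?g 0 x \<partial>lborel) = q"
      using normal_upper_tail[of ?u 0] std_normal_cdf_quantile[of "1 - q"] q
      by (simp flip: zero_ereal_def)
    moreover have "(\<integral>x. ?g \<mu> x \<partial>lborel) = 1 - gaussian_tradeoff \<mu> q"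
      by (simp add: gaussian_tradeoff_def normal_upper_tail)
    ultimately show "1 - gaussian_tradeoff \<mu> q - c * q =
       (\<integral>x. indicator {x. ?u < ereal x} x * h x \<partial>lborel)"
      unfolding h using integrable_upper_tail by simp
    show "integrable lborel (\<lambda>x. indicator {x. ?u < ereal x} x * h x)"
      unfolding h using integrable_upper_tail by simp
  qed
  \<comment> \<open>For positive \<open>\<mu>\<close> the likelihood ratio is strictly increasing,
    and it equals \<open>c\<close> at \<open>t\<close>.\<close>
  have h_sign: "h x \<ge> 0 \<longleftrightarrow> x \<ge> t" for x
  proof -
    have "h x = (exp (\<mu> * x - \<mu>\<^sup>2 / 2) - c) * normal_density 0 1 x"
      by (simp add: h_def normal_density_ratio[of \<mu>] algebra_simps)
    then show ?thesis
      using assms normal_density_pos[of 1 0 x] by (simp add: zero_le_mult_iff not_le c_def)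
  qed
  have "1 - gaussian_tradeoff \<mu> q - c * q \<le> 1 - gaussian_tradeoff \<mu> p - c * p"
    if q: "q \<in> {0..1}" for q
  proof -
    have p: "p \<in> {0..1}"
      using assms by auto
    show ?thesis
      unfolding lagrangian[OF q] lagrangian[OF p]
    proof (rule integral_mono[OF int[OF q] int[OF p]])
      fix x
      \<comment> \<open>The rejection region for \<open>p\<close> omits the point \<open>t\<close>
        itself, which is harmless because \<open>h\<close> vanishes there. Elsewhere that region is
        exactly where \<open>h\<close> is nonnegative, so it maximises pointwise.\<close>
      have "h t = 0"
        by (simp add: h_def c_def normal_density_ratio[of \<mu>])
      then show "indicator {x. std_normal_quantile (1 - q) < ereal x} x * h x
            \<le> indicator {x. std_normal_quantile (1 - p) < ereal x} x * h x"
        using h_sign[of x] by (cases "x = t") (auto simp: t indicator_def)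
    qed
  qed
  then show thesis
    by (intro that[of c]) (auto simp: c_def algebra_simps)
qed

section \<open>Reconstruction attacks\<close>

lemma gdp_event_bound:
  assumes "mechanism N A" "gdp \<mu> A" "neighboring D D'" "E \<in> sets N"
  shows "measure (A D') E \<le> 1 - gaussian_tradeoff \<mu> (measure (A D) E)"
proof -
  have "prob_space (A D)" "prob_space (A D')" and sets: "sets (A D) = sets N" "sets (A D') = sets N"
    using assms(1) by (auto simp: mechanism_def space_prob_algebra)
  interpret P: prob_space "A D" by fact
  interpret Q: prob_space "A D'" by fact
  let ?\<phi> = "indicator E :: _ \<Rightarrow> real"
  let ?X = "{type_II_error (A D') \<phi> |\<phi>. rejection_rule (A D) \<phi> \<and> type_I_error (A D) \<phi> \<le> measure (A D) E}"
  have "type_II_error (A D') ?\<phi> \<in> ?X"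
    using assms(4) sets by (auto simp: rejection_rule_def type_I_error_def indicator_def
        intro!: exI[of _ ?\<phi>] borel_measurable_indicator)
  \<comment> \<open>An infimum of reals lies below every member only if the set is bounded below;
    type II errors are nonnegative.\<close>
  moreover have "bdd_below ?X"
  proof (rule bdd_belowI[of _ 0])
    fix b assume "b \<in> ?X"
    then obtain \<phi> where b: "b = type_II_error (A D') \<phi>" and "rejection_rule (A D) \<phi>"
      by auto
    then have \<phi>: "\<And>y. y \<in> space (A D') \<Longrightarrow> 0 \<le> \<phi> y \<and> \<phi> y \<le> 1"
      and [measurable]: "\<phi> \<in> borel_measurable (A D')"
      using sets_eq_imp_space_eq[of "A D" "A D'"] measurable_cong_sets[of "A D" "A D'" borel borel] sets
      by (auto simp: rejection_rule_def)
    have "(\<integral>y. \<phi> y \<partial>A D') \<le> 1"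
      using \<phi> by (intro Q.integral_le_const Q.integrable_const_bound[where B=1]) auto
    then show "0 \<le> b"
      by (simp add: b type_II_error_def)
  qed
  ultimately have "tradeoff (A D) (A D') (measure (A D) E) \<le> type_II_error (A D') ?\<phi>"
    unfolding tradeoff_def by (rule cInf_lower)
  also have "\<dots> = 1 - measure (A D') E"
    using assms(4) sets by (simp add: type_II_error_def Int_absorb2 sets.sets_into_space)
  finally show ?thesis
    using assms(2,3) P.prob_le_1[of E] measure_nonneg[of "A D" E] unfolding gdp_def
    by (smt (verit) atLeastAtMost_iff)
qed

text \<open>Condition on the index: once \<open>k\<close> is drawn, the attack succeeds exactly when
  its guess is \<open>k\<close>.\<close>

lemma attack_success_eq:
  assumes "mechanism N A" "B \<in> N \<rightarrow>\<^sub>M count_space {1..K}" "set_pmf \<pi> \<subseteq> {1..K}"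
  shows "attack_success N A C \<pi> B =
    (\<Sum>k\<in>{1..K}. pmf \<pi> k * measure (A (C k)) {y \<in> space N. B y = k})"
proof -
  have ps: "prob_space (A D)" and sets: "sets (A D) = sets N" for D
    using assms(1) by (auto simp: mechanism_def space_prob_algebra)
  have sp: "space (A D) = space N" for D
    using sets by (rule sets_eq_imp_space_eq)
  let ?M = "count_space (UNIV :: nat set) \<Otimes>\<^sub>M N"
  let ?f = "\<lambda>k. distr (A (C k)) ?M (\<lambda>y. (k, y))"
  have pair: "(\<lambda>y. (k, y)) \<in> A D \<rightarrow>\<^sub>M ?M" for k D
    using measurable_Pair1'[of k "count_space UNIV" N] measurable_cong_sets[OF sets refl, of D ?M]
    by (simp del: measurable_Pair1')
  have f: "?f \<in> measure_pmf \<pi> \<rightarrow>\<^sub>M subprob_algebra ?M"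
    using prob_space.prob_space_distr[OF ps pair]
    by (auto simp: space_subprob_algebra prob_space_imp_subprob_space)
  have E: "{y \<in> space N. B y = k} \<in> sets N" if "k \<in> {1..K}" for k
    using measurable_sets[OF assms(2), of "{k}"] that by (simp add: vimage_def Int_def conj_commute)
  \<comment> \<open>As \<open>B\<close> takes values in a finite set, the success event is a finite
    union of measurable rectangles.\<close>
  have "{(k, y). (k, y) \<in> space ?M \<and> B y = k} = (\<Union>k\<in>{1..K}. {k} \<times> {y \<in> space N. B y = k})"
    using measurable_space[OF assms(2)] by (auto simp: space_pair_measure)
  also have "\<dots> \<in> sets ?M"
    using E by (intro sets.finite_UN) auto
  finally have X: "{(k, y). (k, y) \<in> space ?M \<and> B y = k} \<in> sets ?M" .
  have "space (attack_experiment N A C \<pi>) = space ?M"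
    unfolding attack_experiment_def by (rule space_bind) auto
  then have "attack_success N A C \<pi> B =
      (\<integral>k. measure (?f k) {(k, y). (k, y) \<in> space ?M \<and> B y = k} \<partial>measure_pmf \<pi>)"
    unfolding attack_success_def
    using subprob_space.measure_bind[OF measure_pmf.subprob_space_axioms f X]
    by (simp only: attack_experiment_def)
  also have "\<dots> = (\<Sum>k\<in>{1..K}. pmf \<pi> k * measure (?f k) {(k, y). (k, y) \<in> space ?M \<and> B y = k})"
    using assms(3) by (subst integral_measure_pmf[of "{1..K}"]) auto
  also have "\<dots> = (\<Sum>k\<in>{1..K}. pmf \<pi> k * measure (A (C k)) {y \<in> space N. B y = k})"
    by (subst measure_distr[OF pair X])
       (auto simp: sp space_pair_measure vimage_def Int_def conj_commute intro!: sum.cong arg_cong2[where f=measure])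
  finally show ?thesis .
qed

lemma candidate_imp_neighboring: "candidate has t D D' \<Longrightarrow> neighboring D D'"
  unfolding candidate_def neighboring_def by metis

theorem lemma3p2:
  fixes \<mu> :: real
    and N :: "'o measure"
    and A :: "'x multiset \<Rightarrow> 'o measure"
    and has :: "'s \<Rightarrow> 'x \<Rightarrow> bool"
    and m :: nat
    and s :: "nat \<Rightarrow> 's"
    and p :: "nat \<Rightarrow> real"
  assumes "\<mu> > 0"
    and "\<forall>j\<in>{1..m}. p j \<in> {0<..<1}"
    and "mechanism N A"
    and "gdp \<mu> A"
  shows "secret_protection N has m s p
           (\<lambda>j. 1 - std_normal_cdf (std_normal_quantile (1 - p j) - ereal \<mu>)) A"
  unfolding secret_protection_def gaussian_tradeoff_def[symmetric]
proof (intro ballI allI impI)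
  fix j K :: nat and D :: "'x multiset" and C :: "nat \<Rightarrow> 'x multiset"
    and \<pi> :: "nat pmf" and B :: "'o \<Rightarrow> nat"
  assume j: "j \<in> {1..m}"
    and cand: "\<forall>k\<in>{1..K}. candidate has (s j) D (C k)"
    and supp: "set_pmf \<pi> \<subseteq> {1..K}"
    and prior: "\<forall>k\<in>{1..K}. pmf \<pi> k \<le> p j"
    and B: "B \<in> N \<rightarrow>\<^sub>M count_space {1..K}"
  have "prob_space (A D)" and sets: "sets (A D) = sets N"
    using assms(3) by (auto simp: mechanism_def space_prob_algebra)
  interpret prob_space "A D" by fact
  define E where "E k = {y \<in> space N. B y = k}" for k
  have E: "E k \<in> sets N" if "k \<in> {1..K}" for k
    using measurable_sets[OF B, of "{k}"] that by (simp add: E_def vimage_def Int_def conj_commute)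
  \<comment> \<open>The slope depends on \<open>p j\<close> but not on \<open>k\<close>, so the
    bounds for all candidates can be averaged linearly.\<close>
  obtain c where c: "c \<ge> 0" "\<And>q. q \<in> {0..1} \<Longrightarrow>
      1 - gaussian_tradeoff \<mu> q \<le> 1 - gaussian_tradeoff \<mu> (p j) + c * (q - p j)"
    using gaussian_tradeoff_supporting_line[OF assms(1), of "p j"] assms(2) j by blast
  have line: "measure (A (C k)) (E k) \<le> 1 - gaussian_tradeoff \<mu> (p j) + c * (prob (E k) - p j)"
    if k: "k \<in> {1..K}" for k
    using gdp_event_bound[OF assms(3,4) candidate_imp_neighboring E[OF k]] cand k c(2)[of "prob (E k)"]
    by fastforce
  have pmf1: "(\<Sum>k\<in>{1..K}. pmf \<pi> k) = 1"
    using sum_pmf_eq_1[OF _ supp] by blast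
  have "(\<Sum>k\<in>{1..K}. prob (E k)) = prob (\<Union>k\<in>{1..K}. E k)"
    using E sets by (intro finite_measure_finite_Union[symmetric])
      (auto simp: disjoint_family_on_def E_def)
  \<comment> \<open>Every guess lies in \<open>{1..K}\<close>, so the events cover the space; all
    are measured under the single law \<open>A D\<close>.\<close>
  also have "(\<Union>k\<in>{1..K}. E k) = space (A D)"
    using measurable_space[OF B] sets_eq_imp_space_eq[OF sets] by (auto simp: E_def)
  finally have E1: "(\<Sum>k\<in>{1..K}. prob (E k)) = 1"
    by (simp add: prob_space)
  have "(\<Sum>k\<in>{1..K}. pmf \<pi> k * prob (E k)) \<le> (\<Sum>k\<in>{1..K}. p j * prob (E k))"
    using prior by (intro sum_mono mult_right_mono) auto
  then have avg: "(\<Sum>k\<in>{1..K}. pmf \<pi> k * prob (E k)) \<le> p j"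
    by (simp only: E1 mult_1_right flip: sum_distrib_left)
  have "attack_success N A C \<pi> B = (\<Sum>k\<in>{1..K}. pmf \<pi> k * measure (A (C k)) (E k))"
    using attack_success_eq[OF assms(3) B supp] by (simp add: E_def)
  also have "\<dots> \<le> (\<Sum>k\<in>{1..K}. pmf \<pi> k * (1 - gaussian_tradeoff \<mu> (p j) + c * (prob (E k) - p j)))"
    using line by (intro sum_mono mult_left_mono) auto
  also have "\<dots> = (1 - gaussian_tradeoff \<mu> (p j) - c * p j) * (\<Sum>k\<in>{1..K}. pmf \<pi> k)
      + c * (\<Sum>k\<in>{1..K}. pmf \<pi> k * prob (E k))"
    by (simp add: sum_distrib_left sum.distrib[symmetric] algebra_simps)
  \<comment> \<open>Since \<open>c\<close> is nonnegative, the averaged level contributes at most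
    \<open>c * p j\<close>, which cancels the constant term of the line.\<close>
  also have "\<dots> \<le> 1 - gaussian_tradeoff \<mu> (p j)"
    using mult_left_mono[OF avg c(1)] unfolding pmf1 by simp
  finally show "attack_success N A C \<pi> B \<le> 1 - gaussian_tradeoff \<mu> (p j)" .
qed

end
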